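(* Let $(A,\mathcal{F})$ be an algebra with $A$ finite. The following are equivalent. (1) $(A,\mathcal{F})$ is a Ramsey algebra. (2) For every $a\in A$, the set $\mathrm{FR}_{\mathcal{F}}(\langle a,a,a,\dotsc\rangle)$ contains an idempotent element for $(A,\mathcal{F})$. (3) $(A,\mathcal{F})$ is a degenerate Ramsey algebra. (4) Every subalgebra of $(A,\mathcal{F})$ contains an idempotent element for $(A,\mathcal{F})$.
   Context: $\omega=\{0,1,2,\dotsc\}$ and $\mathbb{N}$ is the set of positive integers. An algebra is a pair $(A,\mathcal{F})$ where $A$ is a nonempty set and $\mathcal{F}$ is a (possibly empty) collection of finitary operations on $A$, none of which is nullary (so each $f\in\mathcal{F}$ is a map $A^n\to A$ for some $n\in\mathbb{N}$). For a finite sequence $\vec{x}$ whose length is the arity of $f$, $f(\vec{x})$ denotes $f$ applied to the terms of $\vec{x}$ in order; whenever $f(\vec{x})$ is written, the length of $\vec{x}$ is assumed to equal the arity of $f$. The symbol $\ast$ denotes concatenation of sequences. Orderly terms: an operation $f\colon A^m\to A$ is an orderly composition of a collection $\mathcal{C}$ of operations on $A$ if there are $n,k_1,\dotsc,k_n\in\mathbb{N}$ and $g,h_1,\dotsc,h_n\in\mathcal{C}$ such that $g$ is $n$-ary, $h_i$ is $k_i$-ary, $m=\sum_{i=1}^n k_i$, and $f(\vec{x}_1\ast\dotsb\ast\vec{x}_n)=g(h_1(\vec{x}_1),\dotsc,h_n(\vec{x}_n))$ for all finite sequences $\vec{x}_i$ in $A$ of length $k_i$. The collection of orderly terms over $\mathcal{F}$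 is the smallest collection of operations on $A$ that includes $\mathcal{F}$, contains the identity function on $A$, and is closed under orderly composition. Reductions: for infinite sequences $\vec{a},\vec{b}\in{}^{\omega}A$ (sequences indexed by $\omega$), $\vec{b}\leq_{\mathcal{F}}\vec{a}$ ($\vec{b}$ is a reduction of $\vec{a}$) means that there are finite sequences $\vec{a}_k$ and orderly terms $f_k$ over $\mathcal{F}$ ($k\in\omega$) such that $\vec{a}_0\ast\vec{a}_1\ast\vec{a}_2\ast\dotsb$ is a subsequence of $\vec{a}$ and $\vec{b}(k)=f_k(\vec{a}_k)$ for all $k\in\omega$. $\mathrm{FR}_{\mathcal{F}}(\vec{b})$ is the set of all elements $f(\vec{b}_0)$ with $f$ an orderly term over $\mathcal{F}$ and $\vec{b}_0$ a finite subsequence of $\vec{b}$. A sequence $\vec{b}$ is homogeneous for $X\subseteq A$ with respect to $\mathcal{F}$ if $\mathrm{FR}_{\mathcal{F}}(\vec{b})$ is either contained in or disjoint from $X$. $(A,\mathcal{F})$ is a Ramsey algebra if for every $\vec{a}\in{}^{\omega}A$ and $X\subseteq A$ there exists $\vec{b}\leq_{\mathcal{F}}\vec{a}$ that is homogeneous for $X$ with respect to $\mathcal{F}$. It is a degenerate Ramsey algebra if for every $\vec{a}\in{}^{\omega}A$ there exists $\vec{b}\leq_{\mathcal{F}}\vec{a}$ with $|\mathrm{FR}_{\mathcal{F}}(\vec{b})|=1$. An element $e\in A$ is idempotent for $(A,\mathcal{F})$ if $f(e,\dotsc,e)=e$ for every $f\in\mathcal{F}$. A subalgebra of $(A,\mathcal{F})$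 is given by a nonempty subset $B\subseteq A$ closed under every $f\in\mathcal{F}$, with the restricted operations. *)

theory Defs
  imports Main "HOL-Library.FuncSet"
begin

definition tuples :: "'a set \<Rightarrow> nat \<Rightarrow> 'a list set" where
  "tuples A n = {xs. set xs \<subseteq> A \<and> length xs = n}"

text \<open>
  A finitary operation is a pair of its arity and its underlying function, which takes its
  arguments as a list. Functions are extensional (\<open>undefined\<close> off \<open>A\<^sup>n\<close>), so that equality
  of pairs is equality of maps \<open>A\<^sup>n \<rightarrow> A\<close>.
\<close>

type_synonym 'a oper = "nat \<times> ('a list \<Rightarrow> 'a)"

abbreviation arity :: "'a oper \<Rightarrow> nat" where "arity \<equiv> fst"

abbreviation app :: "'a oper \<Rightarrow> 'a list \<Rightarrow> 'a" where "app \<equiv> snd"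

definition operations :: "'a set \<Rightarrow> 'a oper set" where
  "operations A = (SIGMA n:{1..}. tuples A n \<rightarrow>\<^sub>E A)"

definition is_algebra :: "'a set \<Rightarrow> 'a oper set \<Rightarrow> bool" where
  "is_algebra A F \<longleftrightarrow> A \<noteq> {} \<and> F \<subseteq> operations A"

definition id_oper :: "'a set \<Rightarrow> 'a oper" where
  "id_oper A = (1, \<lambda>xs\<in>tuples A 1. hd xs)"

definition orderly_comp :: "'a set \<Rightarrow> 'a oper \<Rightarrow> 'a oper list \<Rightarrow> 'a oper \<Rightarrow> bool" where
  "orderly_comp A g hs f \<longleftrightarrow>
     f \<in> operations A \<and> hs \<noteq> [] \<and> arity g = length hs \<and> arity f = (\<Sum>h\<leftarrow>hs. arity h) \<and>
     (\<forall>xss. list_all2 (\<lambda>h xs. xs \<in> tuples A (arity h)) hs xss \<longrightarrow>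
        app f (concat xss) = app g (map2 app hs xss))"

inductive_set orderly_terms :: "'a set \<Rightarrow> 'a oper set \<Rightarrow> 'a oper set"
  for A :: "'a set" and F :: "'a oper set" where
  base: "f \<in> F \<Longrightarrow> f \<in> orderly_terms A F"
| ident: "id_oper A \<in> orderly_terms A F"
| comp: "\<lbrakk>g \<in> orderly_terms A F; \<forall>h\<in>set hs. h \<in> orderly_terms A F; orderly_comp A g hs f\<rbrakk>
    \<Longrightarrow> f \<in> orderly_terms A F"

text \<open>
  The infinite concatenation \<open>xss 0 @ xss 1 @ \<dots>\<close>. The definition is meaningful when
  all \<open>xss k\<close> are nonempty, since then the first \<open>n + 1\<close> of them have total length greater
  than \<open>n\<close>. It is only used in this case, since all orderly terms have positive arity.
\<close>

definition inf_concat :: "(nat \<Rightarrow> 'a list) \<Rightarrow> nat \<Rightarrow> 'a" where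
  "inf_concat xss n = concat (map xss [0..<Suc n]) ! n"

definition inf_subseq :: "(nat \<Rightarrow> 'a) \<Rightarrow> (nat \<Rightarrow> 'a) \<Rightarrow> bool" where
  "inf_subseq c a \<longleftrightarrow> (\<exists>\<sigma>. strict_mono \<sigma> \<and> c = a \<circ> \<sigma>)"

definition fin_subseq :: "'a list \<Rightarrow> (nat \<Rightarrow> 'a) \<Rightarrow> bool" where
  "fin_subseq xs b \<longleftrightarrow> (\<exists>js. sorted_wrt (<) js \<and> xs = map b js)"

definition reduction :: "'a set \<Rightarrow> 'a oper set \<Rightarrow> (nat \<Rightarrow> 'a) \<Rightarrow> (nat \<Rightarrow> 'a) \<Rightarrow> bool" where
  "reduction A F b a \<longleftrightarrow>
     (\<exists>xss f. (\<forall>k. f k \<in> orderly_terms A F \<and> length (xss k) = arity (f k) \<and>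
                   b k = app (f k) (xss k)) \<and>
        inf_subseq (inf_concat xss) a)"

definition FR :: "'a set \<Rightarrow> 'a oper set \<Rightarrow> (nat \<Rightarrow> 'a) \<Rightarrow> 'a set" where
  "FR A F b = {app f xs |f xs. f \<in> orderly_terms A F \<and> length xs = arity f \<and> fin_subseq xs b}"

definition homogeneous :: "'a set \<Rightarrow> 'a oper set \<Rightarrow> 'a set \<Rightarrow> (nat \<Rightarrow> 'a) \<Rightarrow> bool" where
  "homogeneous A F X b \<longleftrightarrow> FR A F b \<subseteq> X \<or> FR A F b \<inter> X = {}"

definition ramsey_algebra :: "'a set \<Rightarrow> 'a oper set \<Rightarrow> bool" where
  "ramsey_algebra A F \<longleftrightarrow>
     (\<forall>a X. range a \<subseteq> A \<longrightarrow> X \<subseteq> A \<longrightarrow> (\<exists>b. reduction A F b a \<and> homogeneous A F X b))"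

definition degenerate_ramsey_algebra :: "'a set \<Rightarrow> 'a oper set \<Rightarrow> bool" where
  "degenerate_ramsey_algebra A F \<longleftrightarrow>
     (\<forall>a. range a \<subseteq> A \<longrightarrow> (\<exists>b. reduction A F b a \<and> card (FR A F b) = 1))"

definition idempotent_elem :: "'a set \<Rightarrow> 'a oper set \<Rightarrow> 'a \<Rightarrow> bool" where
  "idempotent_elem A F e \<longleftrightarrow> e \<in> A \<and> (\<forall>f\<in>F. app f (replicate (arity f) e) = e)"

definition subalgebra :: "'a set \<Rightarrow> 'a oper set \<Rightarrow> 'a set \<Rightarrow> bool" where
  "subalgebra A F B \<longleftrightarrow>
     B \<noteq> {} \<and> B \<subseteq> A \<and> (\<forall>f\<in>F. \<forall>xs\<in>tuples B (arity f). app f xs \<in> B)"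

lemma id_oper_in_operations: "id_oper A \<in> operations A"
  by (auto simp: id_oper_def operations_def tuples_def length_Suc_conv)

lemma orderly_terms_subset_operations:
  assumes "F \<subseteq> operations A"
  shows "orderly_terms A F \<subseteq> operations A"
proof
  fix f assume "f \<in> orderly_terms A F"
  then show "f \<in> operations A"
    by induction (use assms id_oper_in_operations in \<open>auto simp: orderly_comp_def\<close>)
qed

lemma inf_concat_nth:
  assumes ne: "\<And>k. xss k \<noteq> []" and i: "i < length (xss k)"
  shows "inf_concat xss (length (concat (map xss [0..<k])) + i) = xss k ! i"
proof -
  let ?c = "\<lambda>m. concat (map xss [0..<m])"
  have len: "m \<le> length (?c m)" for m
  proof (induction m)
    case (Suc m)
    then show ?case using ne[of m] by (cases "xss m") auto
  qed simp
  define n where "n = length (?c k) + i"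
  have "k \<le> n" using len[of k] by (simp add: n_def)
  then have "[0..<Suc n] = [0..<Suc k] @ [Suc k..<Suc n]"
    using upt_add_eq_append[of 0 "Suc k" "n - k"] by simp
  then have "?c (Suc n) = ?c k @ xss k @ concat (map xss [Suc k..<Suc n])"
    by simp
  then show ?thesis
    using i by (simp add: inf_concat_def n_def[symmetric] del: upt_Suc) (simp add: n_def nth_append)
qed

end

theory Submission
  imports Defs "HOL-Library.Infinite_Set"
begin

text \<open>
  For constant sequences, \<open>FR\<^sub>F(a, a, \<dots>)\<close> is the subalgebra generated by \<open>a\<close>; this gives
  (2) \<open>\<longleftrightarrow>\<close> (4). If this subalgebra contains an idempotent \<open>e\<close> and \<open>a\<close> occurs infinitely often
  in a sequence, then the constant sequence \<open>e\<close> is a reduction of it, whence (2) \<open>\<longrightarrow>\<close> (3).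

  For (1) \<open>\<longrightarrow>\<close> (2), choose \<open>e\<close> in the subalgebra generated by \<open>a\<close> such that the subalgebra
  generated by \<open>e\<close> has the least possible size. Then every element of it generates all of it. Let
  \<open>b\<close> be a reduction of \<open>(e, e, \<dots>)\<close> that is homogeneous for \<open>{e}\<close>. Some \<open>c\<close> occurs infinitely
  often in \<open>b\<close>, so \<open>FR\<^sub>F(b)\<close> includes the subalgebra generated by \<open>c\<close>, to which \<open>e\<close> belongs.
  Homogeneity forces this subalgebra to be \<open>{e}\<close>, so \<open>e\<close> is idempotent.
\<close>

section \<open>Existence of orderly compositions and closure under orderly terms\<close>

lemma arity_pos: "f \<in> operations A \<Longrightarrow> 1 \<le> arity f"
  by (auto simp: operations_def)

lemma app_in: "f \<in> operations A \<Longrightarrow> xs \<in> tuples A (arity f) \<Longrightarrow> app f xs \<in> A"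
  by (auto simp: operations_def)

text \<open>Inverse to \<open>concat\<close> for prescribed block lengths. It recovers the argument
  tuples of the inner operations from the single argument list of an orderly composition.\<close>

fun split_list_at :: "nat list \<Rightarrow> 'a list \<Rightarrow> 'a list list" where
  "split_list_at [] xs = []"
| "split_list_at (n # ns) xs = take n xs # split_list_at ns (drop n xs)"

lemma split_list_at_concat:
  "split_list_at (map length xss) (concat xss) = xss"
  by (induction xss) auto

lemma split_list_at_tuples:
  "xs \<in> tuples A (sum_list ns) \<Longrightarrow> list_all2 (\<lambda>n ys. ys \<in> tuples A n) ns (split_list_at ns xs)"
proof (induction ns arbitrary: xs)
  case (Cons n ns)
  have "drop n xs \<in> tuples A (sum_list ns)" "take n xs \<in> tuples A n"
    using Cons.prems set_drop_subset[of n xs] set_take_subset[of n xs]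
    by (auto simp: tuples_def)
  with Cons.IH show ?case by simp
qed simp

lemma map2_app_in_tuples:
  assumes "set hs \<subseteq> operations A"
    and "list_all2 (\<lambda>h xs. xs \<in> tuples A (arity h)) hs xss"
  shows "map2 app hs xss \<in> tuples A (length hs)"
  using assms(2,1)
proof (induction rule: list_all2_induct)
  case (Cons h hs xs xss)
  then show ?case by (auto simp: tuples_def intro!: app_in)
qed (simp add: tuples_def)

text \<open>A list whose length is the sum of the arities of \<open>hs\<close> splits in exactly one
  way into blocks of these arities, so the defining equation of the composition can be read as a
  definition.\<close>

lemma ex_orderly_comp:
  assumes g: "g \<in> operations A" and hs: "set hs \<subseteq> operations A" and len: "length hs = arity g"
  shows "\<exists>f. orderly_comp A g hs f"
proof -
  define N where "N = (\<Sum>h\<leftarrow>hs. arity h)"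
  define f :: "'a oper"
    where "f = (N, \<lambda>xs\<in>tuples A N. app g (map2 app hs (split_list_at (map arity hs) xs)))"
  have ne: "hs \<noteq> []" using len arity_pos[OF g] by auto
  then obtain h hs' where "hs = h # hs'" by (cases hs) auto
  then have "1 \<le> N" using hs arity_pos[of h A] by (simp add: N_def)
  moreover have "app g (map2 app hs (split_list_at (map arity hs) xs)) \<in> A"
    if "xs \<in> tuples A N" for xs
  proof (rule app_in[OF g])
    have "list_all2 (\<lambda>h ys. ys \<in> tuples A (arity h)) hs (split_list_at (map arity hs) xs)"
      using split_list_at_tuples[of xs A "map arity hs"] that
      by (simp add: N_def list.rel_map)
    from map2_app_in_tuples[OF hs this]
    show "map2 app hs (split_list_at (map arity hs) xs) \<in> tuples A (arity g)"
      by (simp add: len)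
  qed
  ultimately have f_op: "f \<in> operations A" by (auto simp: f_def operations_def)
  have "app f (concat xss) = app g (map2 app hs xss)"
    if xss: "list_all2 (\<lambda>h xs. xs \<in> tuples A (arity h)) hs xss" for xss
  proof -
    have ar: "map arity hs = map length xss"
      using xss by (induction rule: list_all2_induct) (auto simp: tuples_def)
    then have "length (concat xss) = N" by (simp add: N_def length_concat)
    moreover have "set (concat xss) \<subseteq> A"
      using xss by (induction rule: list_all2_induct) (auto simp: tuples_def)
    ultimately have "concat xss \<in> tuples A N" by (simp add: tuples_def)
    then show ?thesis by (simp add: f_def ar split_list_at_concat)
  qed
  then show ?thesis
    using f_op ne len unfolding orderly_comp_def by (intro exI[of _ f]) (simp add: f_def N_def)
qed

text \<open>Induction on the term. For a composition, the arguments are cut into blocks; the inner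
  terms send the blocks into \<open>B\<close>, and the outer term then stays in
  \<open>B\<close>.\<close>

lemma orderly_term_closed:
  assumes B: "subalgebra A F B"
    and f: "f \<in> orderly_terms A F" and xs: "xs \<in> tuples B (arity f)"
  shows "app f xs \<in> B"
  using f xs
proof (induction arbitrary: xs)
  case (base f)
  then show ?case using B by (auto simp: subalgebra_def)
next
  case ident
  then show ?case using B
    by (auto simp: id_oper_def tuples_def subalgebra_def length_Suc_conv)
next
  case (comp g hs f)
  let ?xss = "split_list_at (map arity hs) xs"
  have ar: "arity f = (\<Sum>h\<leftarrow>hs. arity h)" "arity g = length hs"
    using comp.hyps by (auto simp: orderly_comp_def)
  have spl: "list_all2 (\<lambda>h ys. ys \<in> tuples B (arity h)) hs ?xss"
    using split_list_at_tuples[of xs B "map arity hs"] comp.prems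
    by (simp add: ar list.rel_map)
  have "concat (split_list_at ns ys) = ys" if "length ys = sum_list ns" for ns and ys :: "'a list"
    using that by (induction ns arbitrary: ys) auto
  then have cat: "concat ?xss = xs" using comp.prems by (simp add: ar tuples_def)
  \<comment> \<open>\<open>orderly_comp\<close> quantifies over tuples in \<open>A\<close>, so the
    blocks are also viewed there.\<close>
  have "list_all2 (\<lambda>h ys. ys \<in> tuples A (arity h)) hs ?xss"
    by (rule list_all2_mono[OF spl]) (use B in \<open>auto simp: tuples_def subalgebra_def\<close>)
  then have eq: "app f xs = app g (map2 app hs ?xss)"
    using comp.hyps cat unfolding orderly_comp_def by metis
  have "\<forall>h\<in>set hs. \<forall>xs\<in>tuples B (arity h). app h xs \<in> B" using comp.IH by blast
  with spl have "map2 app hs ?xss \<in> tuples B (length hs)"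
    by (induction rule: list_all2_induct) (auto simp: tuples_def)
  then show ?case using comp.IH(1) by (simp add: eq ar)
qed

section \<open>Constant sequences and generated subalgebras\<close>

lemma fin_subseq_const: "fin_subseq xs (\<lambda>_. a) \<longleftrightarrow> xs = replicate (length xs) a"
proof
  assume "fin_subseq xs (\<lambda>_. a)"
  then show "xs = replicate (length xs) a"
    by (auto simp: fin_subseq_def map_replicate_const)
next
  assume "xs = replicate (length xs) a"
  then have "xs = map (\<lambda>_. a) [0..<length xs]" by (simp add: map_replicate_const)
  then show "fin_subseq xs (\<lambda>_. a)"
    unfolding fin_subseq_def by (intro exI[of _ "[0..<length xs]"]) simp
qed

lemma FR_const: "FR A F (\<lambda>_. a) = (\<lambda>f. app f (replicate (arity f) a)) ` orderly_terms A F"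
proof (intro equalityI subsetI)
  fix x assume "x \<in> FR A F (\<lambda>_. a)"
  then obtain f xs where "x = app f xs" "f \<in> orderly_terms A F" "length xs = arity f"
      "xs = replicate (length xs) a"
    unfolding FR_def fin_subseq_const by blast
  then show "x \<in> (\<lambda>f. app f (replicate (arity f) a)) ` orderly_terms A F"
    by (intro image_eqI[of _ _ f]) simp_all
next
  fix x assume "x \<in> (\<lambda>f. app f (replicate (arity f) a)) ` orderly_terms A F"
  then obtain f where "f \<in> orderly_terms A F" "x = app f (replicate (arity f) a)" by blast
  moreover have "fin_subseq (replicate (arity f) a) (\<lambda>_. a)" by (simp add: fin_subseq_const)
  moreover have "length (replicate (arity f) a) = arity f" by simp
  ultimately show "x \<in> FR A F (\<lambda>_. a)" unfolding FR_def by blast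
qed

lemma FR_const_self: "a \<in> A \<Longrightarrow> a \<in> FR A F (\<lambda>_. a)"
  unfolding FR_const
  by (rule image_eqI[OF _ orderly_terms.ident]) (simp add: id_oper_def tuples_def)

lemma FR_const_subset:
  assumes "subalgebra A F B" and "a \<in> B"
  shows "FR A F (\<lambda>_. a) \<subseteq> B"
proof -
  have "replicate n a \<in> tuples B n" for n using assms(2) by (auto simp: tuples_def)
  then show ?thesis using orderly_term_closed[OF assms(1)] unfolding FR_const by blast
qed

text \<open>If each argument of \<open>g\<close> is a term evaluated at copies of \<open>a\<close>,
  then composing \<open>g\<close> with these terms gives one orderly term whose value at copies of
  \<open>a\<close> is the result. With \<open>FR_const_subset\<close> this makes the set the least
  subalgebra containing \<open>a\<close>.\<close>

lemma subalgebra_FR_const: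
  assumes F: "F \<subseteq> operations A" and a: "a \<in> A"
  shows "subalgebra A F (FR A F (\<lambda>_. a))"
proof -
  note ops = orderly_terms_subset_operations[OF F]
  have "app g xs \<in> FR A F (\<lambda>_. a)"
    if g: "g \<in> F" and xs: "xs \<in> tuples (FR A F (\<lambda>_. a)) (arity g)" for g xs
  proof -
    have "\<forall>x\<in>set xs. \<exists>h. h \<in> orderly_terms A F \<and> x = app h (replicate (arity h) a)"
      using xs unfolding tuples_def FR_const by blast
    then obtain H where H: "\<forall>x\<in>set xs. H x \<in> orderly_terms A F \<and> x = app (H x) (replicate (arity (H x)) a)"
      by metis
    \<comment> \<open>\<open>H\<close> selects a term for each value, so repeated entries of
      \<open>xs\<close> share a term.\<close>
    define hs where "hs = map H xs"
    have hs: "\<forall>h\<in>set hs. h \<in> orderly_terms A F" using H by (auto simp: hs_def)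
    have len: "length hs = arity g" using xs by (simp add: hs_def tuples_def)
    obtain f where f: "orderly_comp A g hs f"
      using ex_orderly_comp[of g A hs] g F hs ops len by blast
    define yss where "yss = map (\<lambda>h. replicate (arity h) a) hs"
    have "list_all2 (\<lambda>h ys. ys \<in> tuples A (arity h)) hs yss"
      using a by (simp add: yss_def list_all2_map2 list_all2_same tuples_def set_replicate_conv_if)
    then have "app f (concat yss) = app g (map2 app hs yss)"
      using f by (simp add: orderly_comp_def)
    moreover have "map2 app hs yss = xs"
      using H by (intro nth_equalityI) (auto simp: yss_def hs_def)
    moreover have "concat yss = replicate (arity f) a"
    proof -
      have "concat yss = replicate (\<Sum>h\<leftarrow>hs. arity h) a"
        unfolding yss_def by (induction hs) (auto simp: replicate_add)
      then show ?thesis using f by (simp add: orderly_comp_def)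
    qed
    moreover have "f \<in> orderly_terms A F"
      using orderly_terms.comp[OF orderly_terms.base[OF g] hs f] .
    ultimately show ?thesis unfolding FR_const by (intro image_eqI[of _ _ f]) simp_all
  qed
  moreover have "FR A F (\<lambda>_. a) \<subseteq> A"
  proof -
    have "replicate n a \<in> tuples A n" for n using a by (auto simp: tuples_def)
    then show ?thesis using ops app_in unfolding FR_const by blast
  qed
  ultimately show ?thesis
    using FR_const_self[OF a] unfolding subalgebra_def by blast
qed

text \<open>Idempotence of \<open>e\<close> means that \<open>{e}\<close> is itself a
  subalgebra.\<close>

lemma FR_const_idempotent:
  assumes F: "F \<subseteq> operations A" and e: "idempotent_elem A F e"
  shows "FR A F (\<lambda>_. e) = {e}"
proof -
  have "e \<in> A" using e by (simp add: idempotent_elem_def)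
  have "app f xs = e" if "f \<in> F" "xs \<in> tuples {e} (arity f)" for f xs
  proof -
    have "xs = replicate (arity f) e"
      using that(2) by (intro replicate_eqI) (auto simp: tuples_def)
    then show ?thesis using e that(1) by (simp add: idempotent_elem_def)
  qed
  then have "subalgebra A F {e}" using \<open>e \<in> A\<close> by (simp add: subalgebra_def)
  then show ?thesis
    using FR_const_subset[of A F "{e}" e] FR_const_self[OF \<open>e \<in> A\<close>, of F] by blast
qed

text \<open>Every operation in \<open>F\<close> is an orderly term, so its value at copies of
  \<open>e\<close> lies in the given set.\<close>

lemma idempotent_elem_if_FR_const:
  assumes "e \<in> A" and "FR A F (\<lambda>_. e) \<subseteq> {e}"
  shows "idempotent_elem A F e"
proof -
  have "app f (replicate (arity f) e) = e" if "f \<in> F" for f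
    using assms(2) orderly_terms.base[OF that, of A] unfolding FR_const by blast
  with assms(1) show ?thesis by (simp add: idempotent_elem_def)
qed

section \<open>Constant subsequences and reductions\<close>

lemma ex_constant_subseq:
  fixes b :: "nat \<Rightarrow> 'a"
  assumes "finite (range b)"
  obtains c and \<sigma> :: "nat \<Rightarrow> nat" where "strict_mono \<sigma>" and "\<And>k. b (\<sigma> k) = c" and "c \<in> range b"
proof -
  obtain k0 where inf: "infinite {k. b k = b k0}"
    using pigeonhole_infinite[of UNIV b] assms by auto
  \<comment> \<open>The increasing enumeration of an infinite fibre of \<open>b\<close> serves as
    \<sigma>.\<close>
  have "b (enumerate {k. b k = b k0} k) = b k0" for k
    using enumerate_in_set[OF inf] by blast
  then show ?thesis
    using that[of "enumerate {k. b k = b k0}" "b k0"] strict_mono_enumerate[OF inf] by blast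
qed

lemma FR_const_subset_FR:
  fixes \<sigma> :: "nat \<Rightarrow> nat"
  assumes "strict_mono \<sigma>" and "\<And>k. b (\<sigma> k) = c"
  shows "FR A F (\<lambda>_. c) \<subseteq> FR A F b"
proof -
  have "fin_subseq (replicate n c) b" for n
    unfolding fin_subseq_def
    using assms
    by (intro exI[of _ "map \<sigma> [0..<n]"])
      (auto simp: sorted_wrt_map strict_mono_less o_def map_replicate_const)
  moreover have "length (replicate n c) = n" for n by simp
  ultimately show ?thesis unfolding FR_const FR_def by blast
qed

text \<open>The same term is applied to consecutive blocks of copies of \<open>c\<close>; the blocks
  concatenate to the constant sequence \<open>c\<close>, which is a subsequence of
  \<open>a\<close>.\<close>

lemma reduction_const:
  fixes \<sigma> :: "nat \<Rightarrow> nat"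
  assumes f: "f \<in> orderly_terms A F" and pos: "1 \<le> arity f"
    and \<sigma>: "strict_mono \<sigma>" "\<And>k. a (\<sigma> k) = c"
  shows "reduction A F (\<lambda>_. app f (replicate (arity f) c)) a"
proof -
  let ?xss = "\<lambda>_::nat. replicate (arity f) c"
  have "inf_concat ?xss m = c" for m
  proof -
    let ?L = "concat (map ?xss [0..<Suc m])"
    have "length ?L = Suc m * arity f"
      by (simp add: length_concat o_def sum_list_triv del: upt_Suc)
    \<comment> \<open>Positive arity keeps the index \<open>m\<close> inside the list, so
      \<open>nth\<close> returns a genuine entry.\<close>
    also have "\<dots> > m" using pos by (cases "arity f") auto
    finally have "?L ! m \<in> set ?L" by (rule nth_mem)
    also have "set ?L \<subseteq> {c}" by auto
    finally show ?thesis by (simp add: inf_concat_def del: upt_Suc)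
  qed
  then have "inf_subseq (inf_concat ?xss) a"
    unfolding inf_subseq_def using \<sigma> by (intro exI[of _ \<sigma>]) (auto simp: fun_eq_iff)
  then show ?thesis
    unfolding reduction_def using f
    by (intro exI[of _ ?xss] exI[of _ "\<lambda>_. f"]) auto
qed

lemma reduction_of_const_in_FR:
  assumes F: "F \<subseteq> operations A" and b: "reduction A F b (\<lambda>_. a)"
  shows "b k \<in> FR A F (\<lambda>_. a)"
proof -
  obtain xss f where f: "\<And>k. f k \<in> orderly_terms A F" "\<And>k. length (xss k) = arity (f k)"
      "\<And>k. b k = app (f k) (xss k)" and sub: "inf_subseq (inf_concat xss) (\<lambda>_. a)"
    using b unfolding reduction_def by blast
  have ne: "xss j \<noteq> []" for j
    using arity_pos[of "f j" A] f(1,2)[of j] orderly_terms_subset_operations[OF F] by fastforce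
  have const: "inf_concat xss n = a" for n
    using sub by (auto simp: inf_subseq_def)
  \<comment> \<open>Each entry of a block reappears in the infinite concatenation, which is
    constant.\<close>
  have "xss k ! i = a" if "i < length (xss k)" for i
    using inf_concat_nth[of xss i k, OF ne that] const by simp
  then have "xss k = replicate (arity (f k)) a"
    by (intro nth_equalityI) (auto simp: f(2))
  then show ?thesis using f(1,3)[of k] by (simp add: FR_const)
qed

section \<open>The implications between the four conditions\<close>

lemma ramsey_imp_idempotent:
  assumes F: "F \<subseteq> operations A" and fin: "finite A"
    and ram: "ramsey_algebra A F" and a: "a \<in> A"
  shows "\<exists>e\<in>FR A F (\<lambda>_. a). idempotent_elem A F e"
proof -
  let ?B = "\<lambda>x. FR A F (\<lambda>_. x)"
  have sub: "?B x \<subseteq> A" if "x \<in> A" for x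
    using subalgebra_FR_const[OF F that] by (simp add: subalgebra_def)
  have B_mono: "?B y \<subseteq> ?B x" if "x \<in> A" "y \<in> ?B x" for x y
    using FR_const_subset[OF subalgebra_FR_const[OF F that(1)] that(2)] .
  obtain e where e: "e \<in> ?B a" and least: "\<And>y. y \<in> ?B a \<Longrightarrow> card (?B e) \<le> card (?B y)"
    using ex_has_least_nat[of "\<lambda>x. x \<in> ?B a" a "\<lambda>x. card (?B x)"] FR_const_self[OF a] by blast
  have eA: "e \<in> A" using e sub[OF a] by blast
  have "range (\<lambda>_::nat. e) \<subseteq> A" "{e} \<subseteq> A" using eA by auto
  then obtain b where red: "reduction A F b (\<lambda>_. e)" and hom: "homogeneous A F {e} b"
    using ram unfolding ramsey_algebra_def by blast
  have b_in: "range b \<subseteq> ?B e" using reduction_of_const_in_FR[OF F red] by blast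
  then have "finite (range b)" using sub[OF eA] fin by (meson finite_subset)
  then obtain c and \<sigma> :: "nat \<Rightarrow> nat" where \<sigma>: "strict_mono \<sigma>" "\<And>k. b (\<sigma> k) = c" and "c \<in> range b"
    by (rule ex_constant_subseq) blast
  then have c: "c \<in> ?B e" using b_in by blast
  then have "c \<in> ?B a" using B_mono[OF a e] by blast
  \<comment> \<open>Minimality of \<open>e\<close> rules out a proper inclusion of these finite
    sets.\<close>
  then have "?B c = ?B e"
    using least B_mono[OF eA c] sub[OF eA] fin by (meson card_seteq finite_subset)
  then have "?B e \<subseteq> FR A F b" using FR_const_subset_FR[where b = b, OF \<sigma>] by metis
  \<comment> \<open>As \<open>e\<close> lies in \<open>FR A F b\<close>, this set meets
    \<open>{e}\<close>, so homogeneity leaves only inclusion in \<open>{e}\<close>.\<close>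
  then have "?B e \<subseteq> {e}"
    using hom FR_const_self[OF eA, of F] unfolding homogeneous_def by blast
  then show ?thesis using idempotent_elem_if_FR_const[OF eA] e by blast
qed

lemma idempotent_imp_degenerate:
  assumes F: "F \<subseteq> operations A" and fin: "finite A"
    and idem: "\<forall>a\<in>A. \<exists>e\<in>FR A F (\<lambda>_. a). idempotent_elem A F e"
  shows "degenerate_ramsey_algebra A F"
  unfolding degenerate_ramsey_algebra_def
proof (intro allI impI)
  fix a :: "nat \<Rightarrow> 'a" assume a: "range a \<subseteq> A"
  then have "finite (range a)" using fin finite_subset by blast
  then obtain c and \<sigma> :: "nat \<Rightarrow> nat" where \<sigma>: "strict_mono \<sigma>" "\<And>k. a (\<sigma> k) = c" and "c \<in> range a"
    by (rule ex_constant_subseq) blast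
  then obtain e where e: "e \<in> FR A F (\<lambda>_. c)" "idempotent_elem A F e" using idem a by blast
  then obtain f where f: "f \<in> orderly_terms A F" "e = app f (replicate (arity f) c)"
    by (auto simp: FR_const)
  have "1 \<le> arity f" using f(1) orderly_terms_subset_operations[OF F] arity_pos by blast
  then have "reduction A F (\<lambda>_. e) a" using reduction_const[where a = a, OF f(1) _ \<sigma>] f(2) by simp
  moreover have "card (FR A F (\<lambda>_. e)) = 1" using FR_const_idempotent[OF F e(2)] by simp
  ultimately show "\<exists>b. reduction A F b a \<and> card (FR A F b) = 1" by blast
qed

text \<open>A one-element set is either contained in \<open>X\<close> or disjoint from it.\<close>

lemma degenerate_imp_ramsey:
  assumes "degenerate_ramsey_algebra A F"
  shows "ramsey_algebra A F"
  unfolding ramsey_algebra_def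
proof (intro allI impI)
  fix a :: "nat \<Rightarrow> 'a" and X
  assume "range a \<subseteq> A"
  then obtain b where "reduction A F b a" "card (FR A F b) = 1"
    using assms unfolding degenerate_ramsey_algebra_def by blast
  moreover from this(2) obtain e where "FR A F b = {e}" by (rule card_1_singletonE)
  then have "homogeneous A F X b" by (simp add: homogeneous_def)
  ultimately show "\<exists>b. reduction A F b a \<and> homogeneous A F X b" by blast
qed

theorem theorem3p9:
  fixes A :: "'a set" and F :: "'a oper set"
  assumes "is_algebra A F" and "finite A"
  shows "(ramsey_algebra A F \<longleftrightarrow> (\<forall>a\<in>A. \<exists>e\<in>FR A F (\<lambda>_. a). idempotent_elem A F e)) \<and>
         ((\<forall>a\<in>A. \<exists>e\<in>FR A F (\<lambda>_. a). idempotent_elem A F e) \<longleftrightarrow> degenerate_ramsey_algebra A F) \<and>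
         (degenerate_ramsey_algebra A F \<longleftrightarrow>
            (\<forall>B. subalgebra A F B \<longrightarrow> (\<exists>e\<in>B. idempotent_elem A F e)))"
    (is "(?R \<longleftrightarrow> ?I) \<and> (_ \<longleftrightarrow> ?D) \<and> (_ \<longleftrightarrow> ?S)")
proof -
  have F: "F \<subseteq> operations A" using assms(1) by (simp add: is_algebra_def)
  have "\<exists>e\<in>B. idempotent_elem A F e" if ?I and B: "subalgebra A F B" for B
  proof -
    \<comment> \<open>Any element of \<open>B\<close> will do, since the subalgebra it generates
      stays inside \<open>B\<close>.\<close>
    obtain a where "a \<in> B" "a \<in> A" using B by (auto simp: subalgebra_def)
    then show ?thesis using FR_const_subset[OF B] \<open>?I\<close> by blast
  qed
  then have "?I \<Longrightarrow> ?S" by blast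
  moreover have "?S \<Longrightarrow> ?I" using subalgebra_FR_const[OF F] by blast
  moreover have "?R \<Longrightarrow> ?I" using ramsey_imp_idempotent[OF F assms(2)] by blast
  moreover have "?I \<Longrightarrow> ?D" by (rule idempotent_imp_degenerate[OF F assms(2)])
  moreover have "?D \<Longrightarrow> ?R" by (rule degenerate_imp_ramsey)
  ultimately show ?thesis by blast
qed

end
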